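(* Let $d,n\ge2$ be integers with $(d,n)\ne(2,2)$. Then the holomorphic bundle $\mathfrak M(d,n)$ over $Q_0(d,n)$ is not trivial.
   Context: $G=PGL(n,\mathbb C)$ acts on $M_n(\mathbb C)$ by $s\cdot A=sAs^{-1}$ (algebra automorphisms) and on the right on $d$-tuples $\mathfrak z=(Z_1,\dots,Z_d)\in M_n(\mathbb C)^d$ by $\mathfrak z\cdot s=s^{-1}\mathfrak z s=(s^{-1}Z_1s,\dots,s^{-1}Z_ds)$. $\mathcal V(d,n)$ is the ($G$-invariant, Zariski-open) set of $\mathfrak z\in M_n(\mathbb C)^d$ such that $Z_1,\dots,Z_d$ generate $M_n(\mathbb C)$ as an algebra over $\mathbb C$. $\mathbb I_0(d,n)$ is the finitely generated algebra of $G$-invariant polynomial functions $M_n(\mathbb C)^d\to\mathbb C$, $Q(d,n)$ its spectrum (affine variety over $\mathbb C$), $\pi_0:M_n(\mathbb C)^d\to Q(d,n)$ the surjective regular map dual to the inclusion of $\mathbb I_0(d,n)$ in the polynomial functions, and $Q_0(d,n)=\pi_0(\mathcal V(d,n))$. By a theorem of Procesi (may be assumed), $Q_0(d,n)$ is an open subset of the smooth points of $Q(d,n)$ and $\pi_0:\mathcal V(d,n)\to Q_0(d,n)$ is a holomorphic principal $G$-bundle. $\mathfrak M(d,n)$ is the associated holomorphic fibre bundle with fibre $M_n(\mathbb C)$: its total space is $\mathcal V(d,n)\times_G M_n(\mathbb C)$, the quotient of $\mathcal V(d,n)\times M_n(\mathbb C)$ by $(\mathfrak z,A)\cdot s=(s^{-1}\mathfrak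 z s,s^{-1}As)$, with projection $\pi([\mathfrak z,A])=\pi_0(\mathfrak z)$; each fibre is an algebra isomorphic to $M_n(\mathbb C)$ via $A\mapsto[\mathfrak z,A]$. "Trivial" means isomorphic, as a holomorphic bundle of algebras (biholomorphically, over the identity of $Q_0(d,n)$, by algebra isomorphisms on fibres), to the product bundle $Q_0(d,n)\times M_n(\mathbb C)$. *)

theory Defs
  imports "HOL-Analysis.Analysis"
begin

section \<open>Complex spaces and holomorphic maps\<close>

text \<open>
  A complex space (in particular a complex manifold) is represented by its topology together with
  its sheaf of holomorphic functions: \<open>hol X U\<close> is the set of functions that are holomorphic
  on the open set \<open>U\<close>; their values outside \<open>U\<close> are irrelevant.  All spaces below are
  reduced, so their structure sheaves are sheaves of complex-valued functions.
\<close>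

record 'a cspace =
  topo :: "'a topology"
  hol :: "'a set \<Rightarrow> ('a \<Rightarrow> complex) set"

abbreviation points :: "('a, 'm) cspace_scheme \<Rightarrow> 'a set" where
  "points X \<equiv> topspace (topo X)"

definition holomorphic_map :: "'a cspace \<Rightarrow> 'b cspace \<Rightarrow> ('a \<Rightarrow> 'b) \<Rightarrow> bool" where
  "holomorphic_map X Y f \<longleftrightarrow>
     continuous_map (topo X) (topo Y) f \<and>
     (\<forall>U h. openin (topo Y) U \<longrightarrow> h \<in> hol Y U \<longrightarrow> h \<circ> f \<in> hol X {x \<in> points X. f x \<in> U})"

definition biholomorphic_map :: "'a cspace \<Rightarrow> 'b cspace \<Rightarrow> ('a \<Rightarrow> 'b) \<Rightarrow> bool" where
  "biholomorphic_map X Y f \<longleftrightarrow>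
     holomorphic_map X Y f \<and>
     (\<exists>g. holomorphic_map Y X g \<and>
          (\<forall>x \<in> points X. g (f x) = x) \<and> (\<forall>y \<in> points Y. f (g y) = y))"

text \<open>
  Holomorphic functions of several variables.  The space $\mathbb{C}^I$, for a finite index set
  \<open>I\<close>, is the set of complex-valued functions that are \<open>undefined\<close> off \<open>I\<close>, with the
  product topology; holomorphic means complex Frechet differentiable at every point of an open set.
\<close>

definition hol_on_CI :: "'k set \<Rightarrow> ('k \<Rightarrow> complex) set \<Rightarrow> (('k \<Rightarrow> complex) \<Rightarrow> complex) \<Rightarrow> bool" where
  "hol_on_CI I W F \<longleftrightarrow>
     openin (product_topology (\<lambda>_. euclidean) I) W \<and>
     (\<forall>w \<in> W. \<exists>a. \<forall>\<epsilon>>0. \<exists>\<delta>>0. \<forall>v \<in> W. (\<forall>i\<in>I. cmod (v i - w i) < \<delta>) \<longrightarrow>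
        cmod (F v - F w - (\<Sum>i\<in>I. a i * (v i - w i))) \<le> \<epsilon> * (\<Sum>i\<in>I. cmod (v i - w i)))"

definition eval_at :: "('a \<Rightarrow> complex) set \<Rightarrow> 'a \<Rightarrow> ('a \<Rightarrow> complex) \<Rightarrow> complex" where
  "eval_at \<Phi> x = (\<lambda>\<phi>\<in>\<Phi>. \<phi> x)"

text \<open>
  \<open>hol_generated \<Phi> U h\<close>: near every point of \<open>U\<close>, \<open>h\<close> is a holomorphic function
  of finitely many members of \<open>\<Phi>\<close>.
\<close>

definition hol_generated :: "('a \<Rightarrow> complex) set \<Rightarrow> 'a set \<Rightarrow> ('a \<Rightarrow> complex) \<Rightarrow> bool" where
  "hol_generated \<Phi> U h \<longleftrightarrow>
     (\<forall>x \<in> U. \<exists>I W F. finite I \<and> I \<subseteq> \<Phi> \<and> hol_on_CI I W F \<and> eval_at I x \<in> W \<and>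
        (\<forall>y \<in> U. eval_at I y \<in> W \<longrightarrow> h y = F (eval_at I y)))"

text \<open>
  The complex space with point set \<open>S\<close> and global coordinate functions \<open>\<Phi>\<close>.  If \<open>S\<close>
  is an affine variety and \<open>\<Phi>\<close> its coordinate ring (equivalently, any set of algebra generators
  of it), this is the (reduced) complex analytic space of the variety, with its Euclidean topology;
  if \<open>S\<close> is an open subset of $\mathbb{C}^N$ and \<open>\<Phi>\<close> the set of linear coordinates, it
  is the usual complex manifold \<open>S\<close>.
\<close>

definition coord_space :: "'a set \<Rightarrow> ('a \<Rightarrow> complex) set \<Rightarrow> 'a cspace" where
  "coord_space S \<Phi> =
     \<lparr>topo = pullback_topology S (eval_at \<Phi>) (product_topology (\<lambda>_. euclidean) \<Phi>),
      hol = (\<lambda>U. {h. hol_generated \<Phi> U h})\<rparr>"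

definition open_subspace :: "'a cspace \<Rightarrow> 'a set \<Rightarrow> 'a cspace" where
  "open_subspace X S = \<lparr>topo = subtopology (topo X) S, hol = hol X\<rparr>"

definition prod_cspace :: "'a cspace \<Rightarrow> 'b cspace \<Rightarrow> ('a \<times> 'b) cspace" where
  "prod_cspace X Y =
     \<lparr>topo = prod_topology (topo X) (topo Y),
      hol = (\<lambda>U. {h. \<forall>p \<in> U. \<exists>A B. openin (topo X) A \<and> openin (topo Y) B \<and>
               p \<in> A \<times> B \<and> A \<times> B \<subseteq> U \<and>
               hol_generated ((\<lambda>g. g \<circ> fst) ` hol X A \<union> (\<lambda>g. g \<circ> snd) ` hol Y B) (A \<times> B) h})\<rparr>"

text \<open>
  The quotient of a complex space by an equivalence relation: quotient topology, and a function is
  holomorphic iff its pullback along the quotient map is.  For the quotient of a complex manifold by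
  a free and proper action this is the usual quotient manifold, for which the quotient map is a
  holomorphic submersion.
\<close>

definition quotient_cspace :: "'a cspace \<Rightarrow> ('a \<times> 'a) set \<Rightarrow> 'a set cspace" where
  "quotient_cspace X R =
     \<lparr>topo = topology (\<lambda>U. U \<subseteq> points X // R \<and> openin (topo X) {x \<in> points X. R `` {x} \<in> U}),
      hol = (\<lambda>U. {h. (\<lambda>x. h (R `` {x})) \<in> hol X {x \<in> points X. R `` {x} \<in> U}})\<rparr>"

lemma topspace_coord_space [simp]: "points (coord_space S \<Phi>) = S"
  by (auto simp: coord_space_def topspace_pullback_topology eval_at_def)

lemma istopology_quotient_cspace:
  "istopology (\<lambda>U. U \<subseteq> points X // R \<and> openin (topo X) {x \<in> points X. R `` {x} \<in> U})"
proof -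
  have 1: "{x \<in> points X. R `` {x} \<in> S \<inter> T} =
      {x \<in> points X. R `` {x} \<in> S} \<inter> {x \<in> points X. R `` {x} \<in> T}" for S T
    by auto
  have 2: "{x \<in> points X. R `` {x} \<in> \<Union>K} = (\<Union>S\<in>K. {x \<in> points X. R `` {x} \<in> S})" for K
    by auto
  show ?thesis
    unfolding istopology_def 1 2 by blast
qed

lemma openin_quotient_cspace:
  "openin (topo (quotient_cspace X R)) U \<longleftrightarrow>
     U \<subseteq> points X // R \<and> openin (topo X) {x \<in> points X. R `` {x} \<in> U}"
  using istopology_quotient_cspace[of X R]
  by (simp add: quotient_cspace_def topology_inverse')

lemma topspace_quotient_cspace [simp]: "points (quotient_cspace X R) = points X // R"
proof
  show "points (quotient_cspace X R) \<subseteq> points X // R"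
    using openin_quotient_cspace[of X R "points (quotient_cspace X R)"] by simp
  have "{x \<in> points X. R `` {x} \<in> points X // R} = points X"
    by (auto intro: quotientI)
  then have "openin (topo (quotient_cspace X R)) (points X // R)"
    by (simp add: openin_quotient_cspace)
  then show "points X // R \<subseteq> points (quotient_cspace X R)"
    by (rule openin_subset)
qed

section \<open>Holomorphic bundles of algebras\<close>

text \<open>
  \<open>fadd\<close>, \<open>fmul\<close> and \<open>fscale\<close> are the algebra operations of the fibres; \<open>fadd\<close> and
  \<open>fmul\<close> are meaningful only for two points of the same fibre.
\<close>

record ('e, 'b) algebra_bundle =
  total :: "'e cspace"
  base :: "'b cspace"
  bproj :: "'e \<Rightarrow> 'b"
  fadd :: "'e \<Rightarrow> 'e \<Rightarrow> 'e"
  fmul :: "'e \<Rightarrow> 'e \<Rightarrow> 'e"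
  fscale :: "complex \<Rightarrow> 'e \<Rightarrow> 'e"

text \<open>
  Preservation of the units of the fibres is automatic, the maps on fibres being bijective and
  multiplicative.
\<close>

definition algebra_bundle_iso ::
    "('e, 'b) algebra_bundle \<Rightarrow> ('f, 'b) algebra_bundle \<Rightarrow> ('e \<Rightarrow> 'f) \<Rightarrow> bool" where
  "algebra_bundle_iso E E' \<Psi> \<longleftrightarrow>
     base E = base E' \<and>
     biholomorphic_map (total E) (total E') \<Psi> \<and>
     (\<forall>p \<in> points (total E). bproj E' (\<Psi> p) = bproj E p) \<and>
     (\<forall>p \<in> points (total E). \<forall>q \<in> points (total E). bproj E p = bproj E q \<longrightarrow>
        \<Psi> (fadd E p q) = fadd E' (\<Psi> p) (\<Psi> q) \<and>
        \<Psi> (fmul E p q) = fmul E' (\<Psi> p) (\<Psi> q)) \<and>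
     (\<forall>c. \<forall>p \<in> points (total E). \<Psi> (fscale E c p) = fscale E' c (\<Psi> p))"

definition isomorphic_algebra_bundles ::
    "('e, 'b) algebra_bundle \<Rightarrow> ('f, 'b) algebra_bundle \<Rightarrow> bool" where
  "isomorphic_algebra_bundles E E' \<longleftrightarrow> (\<exists>\<Psi>. algebra_bundle_iso E E' \<Psi>)"

section \<open>Matrices, conjugation and invariants\<close>

type_synonym 'n cmat = "complex^'n^'n"
type_synonym ('d, 'n) mtuple = "(complex^'n^'n)^'d"
type_synonym ('d, 'n) qpoint = "(((complex^'n^'n)^'d) \<Rightarrow> complex) \<Rightarrow> complex"
type_synonym ('d, 'n) mpoint = "(((complex^'n^'n)^'d) \<times> (complex^'n^'n)) set"

definition cscale :: "complex \<Rightarrow> ('n::finite) cmat \<Rightarrow> 'n cmat" where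
  "cscale c A = (\<chi> i j. c * A $ i $ j)"

text \<open>
  The right action of $PGL(n,\mathbb{C})$ by conjugation, written with representatives in
  $GL(n,\mathbb{C})$: scalar matrices act trivially, so that orbits and invariants of the two groups
  coincide.
\<close>

definition conj_mat :: "('n::finite) cmat \<Rightarrow> 'n cmat \<Rightarrow> 'n cmat" where
  "conj_mat s A = matrix_inv s ** A ** s"

definition conj_tuple :: "('n::finite) cmat \<Rightarrow> ('d::finite, 'n) mtuple \<Rightarrow> ('d, 'n) mtuple" where
  "conj_tuple s z = (\<chi> k. conj_mat s (z $ k))"

lemma matrix_inv_mult:
  fixes s :: "'n::finite cmat"
  assumes "invertible s"
  shows "s ** matrix_inv s = mat 1" and "matrix_inv s ** s = mat 1"
  using someI_ex[OF assms[unfolded invertible_def]] unfolding matrix_inv_def by auto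

lemma conj_mat_one: "invertible s \<Longrightarrow> conj_mat s (mat 1) = mat 1"
  by (simp add: conj_mat_def matrix_inv_mult)

lemma conj_mat_add: "conj_mat s (A + B) = conj_mat s A + conj_mat s B"
  by (simp add: conj_mat_def matrix_matrix_mult_def vec_eq_iff sum.distrib algebra_simps)

lemma conj_mat_mult:
  assumes "invertible s"
  shows "conj_mat s (A ** B) = conj_mat s A ** conj_mat s B"
proof -
  have "conj_mat s A ** conj_mat s B = matrix_inv s ** A ** (s ** matrix_inv s) ** B ** s"
    by (simp add: conj_mat_def matrix_mul_assoc)
  then show ?thesis
    using assms by (simp add: conj_mat_def matrix_inv_mult matrix_mul_assoc)
qed

lemma cscale_mult_left: "cscale c A ** B = cscale c (A ** B)"
  by (simp add: cscale_def matrix_matrix_mult_def vec_eq_iff sum_distrib_left mult.assoc)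

lemma cscale_mult_right: "A ** cscale c B = cscale c (A ** B)"
  by (simp add: cscale_def matrix_matrix_mult_def vec_eq_iff sum_distrib_left mult.left_commute)

lemma conj_mat_cscale: "conj_mat s (cscale c A) = cscale c (conj_mat s A)"
  by (simp add: conj_mat_def cscale_mult_left cscale_mult_right)

lemma conj_mat_id: "conj_mat (mat 1) A = (A :: 'n::finite cmat)"
proof -
  have "matrix_inv (mat 1 :: 'n cmat) = mat 1"
    using matrix_inv_mult(1)[of "mat 1 :: 'n cmat"] by (simp add: invertible_def)
  then show ?thesis by (simp add: conj_mat_def)
qed

lemma invertible_matrix_inv: "invertible s \<Longrightarrow> invertible (matrix_inv (s :: 'n::finite cmat))"
  using matrix_inv_mult[of s] unfolding invertible_def by blast

lemma matrix_inv_eqI: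
  fixes s :: "'n::finite cmat"
  assumes "s ** t = mat 1"
  shows "matrix_inv s = t"
proof -
  have "invertible s" using assms invertible_right_inverse by blast
  then have "matrix_inv s = matrix_inv s ** (s ** t)" and "matrix_inv s ** s = mat 1"
    by (simp_all add: assms matrix_inv_mult)
  then show ?thesis by (metis matrix_mul_assoc matrix_mul_lid)
qed

lemma conj_mat_conj_mat:
  assumes "invertible s" "invertible t"
  shows "conj_mat t (conj_mat s A) = conj_mat (s ** t) A"
proof -
  have "s ** t ** (matrix_inv t ** matrix_inv s) = s ** (t ** matrix_inv t) ** matrix_inv s"
    by (simp add: matrix_mul_assoc)
  then have "matrix_inv (s ** t) = matrix_inv t ** matrix_inv s"
    using assms by (intro matrix_inv_eqI) (simp add: matrix_inv_mult)
  then show ?thesis by (simp add: conj_mat_def matrix_mul_assoc)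
qed

lemma conj_mat_inverse:
  assumes "invertible s"
  shows "conj_mat (matrix_inv s) (conj_mat s A) = A"
    and "conj_mat s (conj_mat (matrix_inv s) A) = A"
  using assms by (simp_all add: conj_mat_conj_mat invertible_matrix_inv matrix_inv_mult conj_mat_id)

inductive_set generated_algebra :: "('d::finite, 'n::finite) mtuple \<Rightarrow> ('n cmat) set"
  for z :: "('d, 'n) mtuple" where
  one: "mat 1 \<in> generated_algebra z"
| gen: "z $ k \<in> generated_algebra z"
| add: "A \<in> generated_algebra z \<Longrightarrow> B \<in> generated_algebra z \<Longrightarrow> A + B \<in> generated_algebra z"
| mult: "A \<in> generated_algebra z \<Longrightarrow> B \<in> generated_algebra z \<Longrightarrow> A ** B \<in> generated_algebra z"
| scale: "A \<in> generated_algebra z \<Longrightarrow> cscale c A \<in> generated_algebra z"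

definition generating_tuples :: "(('d::finite, 'n::finite) mtuple) set" where
  "generating_tuples = {z. generated_algebra z = UNIV}"

lemma conj_tuple_generating:
  assumes "z \<in> generating_tuples" "invertible s"
  shows "conj_tuple s z \<in> generating_tuples"
proof -
  have "conj_mat s A \<in> generated_algebra (conj_tuple s z)" if "A \<in> generated_algebra z" for A
    using that
  proof induction
    case (gen k)
    then show ?case
      using generated_algebra.gen[of "conj_tuple s z" k] by (simp add: conj_tuple_def)
  qed (auto simp: conj_mat_one conj_mat_add conj_mat_mult conj_mat_cscale assms
         intro: generated_algebra.intros)
  then show ?thesis
    using assms conj_mat_inverse(2)[OF assms(2)] unfolding generating_tuples_def
    by (metis (mono_tags, lifting) UNIV_I UNIV_eq_I mem_Collect_eq)
qed

lemma conj_tuple_eq_imp_conj_mat_eq: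
  assumes "z \<in> generating_tuples" "invertible s" "invertible t" "conj_tuple s z = conj_tuple t z"
  shows "conj_mat s A = conj_mat t A"
proof -
  have "A \<in> generated_algebra z" using assms(1) by (simp add: generating_tuples_def)
  then show ?thesis
  proof induction
    case (gen k)
    then show ?case using assms(4) by (simp add: conj_tuple_def vec_eq_iff)
  qed (auto simp: conj_mat_one conj_mat_add conj_mat_mult conj_mat_cscale assms)
qed

inductive_set polynomial_functions :: "(('d::finite, 'n::finite) mtuple \<Rightarrow> complex) set" where
  const: "(\<lambda>_. c) \<in> polynomial_functions"
| coord: "(\<lambda>z. z $ k $ i $ j) \<in> polynomial_functions"
| add: "f \<in> polynomial_functions \<Longrightarrow> g \<in> polynomial_functions \<Longrightarrow>
    (\<lambda>z. f z + g z) \<in> polynomial_functions"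
| mult: "f \<in> polynomial_functions \<Longrightarrow> g \<in> polynomial_functions \<Longrightarrow>
    (\<lambda>z. f z * g z) \<in> polynomial_functions"

definition invariant_polynomials :: "(('d::finite, 'n::finite) mtuple \<Rightarrow> complex) set" where
  "invariant_polynomials =
     {f \<in> polynomial_functions. \<forall>s z. invertible s \<longrightarrow> f (conj_tuple s z) = f z}"

text \<open>
  The spectrum of the algebra of invariants as a classical complex affine variety: its points are the
  unital $\mathbb{C}$-algebra homomorphisms from the invariants to $\mathbb{C}$ (equivalently, the
  maximal ideals), its coordinate functions the evaluations at the invariants.
\<close>

definition Q_points :: "(('d::finite, 'n::finite) qpoint) set" where
  "Q_points =
     {x \<in> extensional invariant_polynomials.
        (\<forall>c. x (\<lambda>_. c) = c) \<and>
        (\<forall>f \<in> invariant_polynomials. \<forall>g \<in> invariant_polynomials.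
           x (\<lambda>z. f z + g z) = x f + x g \<and> x (\<lambda>z. f z * g z) = x f * x g)}"

definition Q_space :: "(('d::finite, 'n::finite) qpoint) cspace" where
  "Q_space = coord_space Q_points ((\<lambda>f x. x f) ` invariant_polynomials)"

definition \<pi>\<^sub>0 :: "('d::finite, 'n::finite) mtuple \<Rightarrow> ('d, 'n) qpoint" where
  "\<pi>\<^sub>0 z = (\<lambda>f\<in>invariant_polynomials. f z)"

definition Q0_space :: "(('d::finite, 'n::finite) qpoint) cspace" where
  "Q0_space = open_subspace Q_space (\<pi>\<^sub>0 ` generating_tuples)"

lemma invariant_polynomials_closed:
  "(\<lambda>_. c) \<in> invariant_polynomials"
  "f \<in> invariant_polynomials \<Longrightarrow> g \<in> invariant_polynomials \<Longrightarrow>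
     (\<lambda>z. f z + g z) \<in> invariant_polynomials"
  "f \<in> invariant_polynomials \<Longrightarrow> g \<in> invariant_polynomials \<Longrightarrow>
     (\<lambda>z. f z * g z) \<in> invariant_polynomials"
  by (auto simp: invariant_polynomials_def intro: polynomial_functions.intros)

lemma \<pi>\<^sub>0_in_Q_points: "\<pi>\<^sub>0 z \<in> Q_points"
  by (simp add: \<pi>\<^sub>0_def Q_points_def invariant_polynomials_closed)

lemma \<pi>\<^sub>0_conj_tuple: "invertible s \<Longrightarrow> \<pi>\<^sub>0 (conj_tuple s z) = \<pi>\<^sub>0 z"
  by (auto simp: \<pi>\<^sub>0_def invariant_polynomials_def intro!: restrict_ext)

lemma points_Q0_space: "points Q0_space = \<pi>\<^sub>0 ` generating_tuples"
  using \<pi>\<^sub>0_in_Q_points by (auto simp: Q0_space_def open_subspace_def Q_space_def)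

section \<open>The associated bundle\<close>

definition matrix_space :: "(('n::finite) cmat) cspace" where
  "matrix_space = coord_space UNIV (range (\<lambda>(i, j) A. A $ i $ j))"

text \<open>
  $\mathcal{V}(d,n) \times M_n(\mathbb{C})$ as an open subset of $\mathbb{C}^{dn^2+n^2}$.
\<close>

definition VM_space :: "(('d::finite, 'n::finite) mtuple \<times> 'n cmat) cspace" where
  "VM_space = coord_space (generating_tuples \<times> UNIV)
     (range (\<lambda>(k, i, j) (z, A). z $ k $ i $ j) \<union> range (\<lambda>(i, j) (z, A). A $ i $ j))"

definition orbit_rel ::
    "((('d::finite, 'n::finite) mtuple \<times> 'n cmat) \<times> (('d, 'n) mtuple \<times> 'n cmat)) set" where
  "orbit_rel = {((z, A), (w, B)). z \<in> generating_tuples \<and>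
     (\<exists>s. invertible s \<and> w = conj_tuple s z \<and> B = conj_mat s A)}"

text \<open>
  A point of the total space is an orbit $[\mathfrak{z},A]$, that is, the graph of a function from
  the orbit of $\mathfrak{z}$ to $M_n(\mathbb{C})$ (the stabilizer of $\mathfrak{z}$ consists of
  scalars).  The fibre operations are those for which $A \mapsto [\mathfrak{z},A]$ is an isomorphism
  of algebras, namely the pointwise operations on these functions; see \<open>fadd_orbit\<close> etc. below.
\<close>

definition matrix_bundle ::
    "(('d::finite, 'n::finite) mpoint, ('d, 'n) qpoint) algebra_bundle" where
  "matrix_bundle =
     \<lparr>total = quotient_cspace VM_space orbit_rel,
      base = Q0_space,
      bproj = (\<lambda>p. the_elem ((\<lambda>(z, A). \<pi>\<^sub>0 z) ` p)),
      fadd = (\<lambda>p q. {(z, A + B) | z A B. (z, A) \<in> p \<and> (z, B) \<in> q}),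
      fmul = (\<lambda>p q. {(z, A ** B) | z A B. (z, A) \<in> p \<and> (z, B) \<in> q}),
      fscale = (\<lambda>c p. {(z, cscale c A) | z A. (z, A) \<in> p})\<rparr>"

lemma equiv_orbit_rel:
  "equiv (points VM_space) (orbit_rel ::
     ((('d::finite, 'n::finite) mtuple \<times> 'n cmat) \<times> (('d, 'n) mtuple \<times> 'n cmat)) set)"
  (is "equiv _ ?R")
proof (rule equivI)
  show "?R \<subseteq> points VM_space \<times> points VM_space"
    by (auto simp: VM_space_def orbit_rel_def conj_tuple_generating)
  have "(x, x) \<in> orbit_rel" if "x \<in> points VM_space" for x :: "('d, 'n) mtuple \<times> 'n cmat"
  proof (cases x)
    case (Pair z A)
    moreover have "z \<in> generating_tuples"
      using that by (simp add: Pair VM_space_def)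
    moreover have "invertible (mat 1 :: 'n cmat)" by (simp add: invertible_def)
    moreover have "z = conj_tuple (mat 1) z" "A = conj_mat (mat 1) A"
      by (simp_all add: conj_tuple_def conj_mat_id)
    ultimately show ?thesis
      unfolding orbit_rel_def by blast
  qed
  then show "refl_on (points VM_space) ?R"
    by (rule refl_onI)
  show "sym ?R"
  proof (rule symI, clarify)
    fix z w :: "('d, 'n) mtuple" and A B :: "'n cmat"
    assume "((z, A), (w, B)) \<in> orbit_rel"
    then obtain s where z: "z \<in> generating_tuples" and s: "invertible s"
      and w: "w = conj_tuple s z" and B: "B = conj_mat s A"
      by (auto simp: orbit_rel_def)
    have "z = conj_tuple (matrix_inv s) w" "A = conj_mat (matrix_inv s) B"
      using s by (simp_all add: w B conj_tuple_def conj_mat_inverse)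
    then show "((w, B), (z, A)) \<in> orbit_rel"
      using conj_tuple_generating[OF z s] invertible_matrix_inv[OF s]
      unfolding orbit_rel_def w[symmetric] by blast
  qed
  show "trans ?R"
  proof (rule transI, clarify)
    fix z w v :: "('d, 'n) mtuple" and A B C :: "'n cmat"
    assume "((z, A), (w, B)) \<in> orbit_rel" "((w, B), (v, C)) \<in> orbit_rel"
    then obtain s t where "z \<in> generating_tuples" "invertible s" "invertible t"
      "w = conj_tuple s z" "B = conj_mat s A" "v = conj_tuple t w" "C = conj_mat t B"
      by (auto simp: orbit_rel_def)
    then show "((z, A), (v, C)) \<in> orbit_rel"
      by (auto simp: orbit_rel_def conj_tuple_def conj_mat_conj_mat invertible_mult
          intro!: exI[of _ "s ** t"])
  qed
qed

lemma orbit_eq: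
  assumes "z \<in> generating_tuples"
  shows "orbit_rel `` {(z, A)} = {(conj_tuple s z, conj_mat s A) | s. invertible s}"
  using assms by (auto simp: orbit_rel_def)

lemma bproj_orbit:
  fixes z :: "('d::finite, 'n::finite) mtuple"
  assumes "z \<in> generating_tuples"
  shows "bproj matrix_bundle (orbit_rel `` {(z, A)}) = \<pi>\<^sub>0 z"
proof -
  have "invertible (mat 1 :: 'n cmat)" by (simp add: invertible_def)
  moreover have "conj_tuple (mat 1) z = z" by (simp add: conj_tuple_def conj_mat_id)
  ultimately have "(\<lambda>(z, A). \<pi>\<^sub>0 z) ` (orbit_rel `` {(z, A)}) = {\<pi>\<^sub>0 z}"
    unfolding orbit_eq[OF assms]
    by (auto simp: \<pi>\<^sub>0_conj_tuple image_iff intro!: exI[of _ z] exI[of _ "mat 1"])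
  then show ?thesis by (simp add: matrix_bundle_def)
qed

lemma fadd_orbit:
  assumes "z \<in> generating_tuples"
  shows "fadd matrix_bundle (orbit_rel `` {(z, A)}) (orbit_rel `` {(z, B)}) =
         orbit_rel `` {(z, A + B)}" (is "?L = ?R")
proof
  show "?L \<subseteq> ?R"
  proof
    fix p assume "p \<in> ?L"
    then obtain s t where "invertible s" "invertible t" "conj_tuple s z = conj_tuple t z"
      and "p = (conj_tuple s z, conj_mat s A + conj_mat t B)"
      by (auto simp: matrix_bundle_def orbit_eq[OF assms])
    then show "p \<in> ?R"
      using conj_tuple_eq_imp_conj_mat_eq[OF assms, of s t B]
      by (auto simp: orbit_eq[OF assms] conj_mat_add intro!: exI[of _ s])
  qed
  show "?R \<subseteq> ?L"
    by (auto simp: matrix_bundle_def orbit_eq[OF assms] conj_mat_add)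
qed

lemma fmul_orbit:
  assumes "z \<in> generating_tuples"
  shows "fmul matrix_bundle (orbit_rel `` {(z, A)}) (orbit_rel `` {(z, B)}) =
         orbit_rel `` {(z, A ** B)}" (is "?L = ?R")
proof
  show "?L \<subseteq> ?R"
  proof
    fix p assume "p \<in> ?L"
    then obtain s t where "invertible s" "invertible t" "conj_tuple s z = conj_tuple t z"
      and "p = (conj_tuple s z, conj_mat s A ** conj_mat t B)"
      by (auto simp: matrix_bundle_def orbit_eq[OF assms])
    then show "p \<in> ?R"
      using conj_tuple_eq_imp_conj_mat_eq[OF assms, of s t B]
      by (auto simp: orbit_eq[OF assms] conj_mat_mult intro!: exI[of _ s])
  qed
  show "?R \<subseteq> ?L"
    by (auto simp: matrix_bundle_def orbit_eq[OF assms] conj_mat_mult) blast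
qed

lemma fscale_orbit:
  assumes "z \<in> generating_tuples"
  shows "fscale matrix_bundle c (orbit_rel `` {(z, A)}) = orbit_rel `` {(z, cscale c A)}"
  by (auto simp: matrix_bundle_def orbit_eq[OF assms] conj_mat_cscale)

definition product_bundle ::
    "'b cspace \<Rightarrow> ('b \<times> ('n::finite) cmat, 'b) algebra_bundle" where
  "product_bundle X =
     \<lparr>total = prod_cspace X matrix_space,
      base = X,
      bproj = fst,
      fadd = (\<lambda>(x, A) (y, B). (x, A + B)),
      fmul = (\<lambda>(x, A) (y, B). (x, A ** B)),
      fscale = (\<lambda>c (x, A). (x, cscale c A))\<rparr>"

definition trivial_matrix_bundle :: "('e, 'b) algebra_bundle \<Rightarrow> ('n::finite) itself \<Rightarrow> bool" where
  "trivial_matrix_bundle E _ \<longleftrightarrow>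
     isomorphic_algebra_bundles E
       (product_bundle (base E) :: ('b \<times> 'n cmat, 'b) algebra_bundle)"

end

theory Submission
  imports Defs "HOL-Complex_Analysis.Conformal_Mappings"
begin

text \<open>
  A trivialization of the bundle restricts on fibres to algebra endomorphisms \<open>\<phi> z\<close> of
  $M_n(\mathbb{C})$ (\<open>fibre_map\<close> below), one for each generating tuple \<open>z\<close>, which are
  unital, depend holomorphically on \<open>z\<close>, and satisfy
  \<open>\<phi> (conj_tuple s z) (conj_mat s A) = \<phi> z A\<close> for all invertible \<open>s\<close>.  The tuples
  that do not generate have codimension $(d-1)(n-1) \ge 2$, so by Hartogs \<open>\<phi>\<close> extends to all
  tuples.  At a tuple fixed by a non-scalar \<open>s\<close> the extension is still a unital algebra
  endomorphism, hence injective as $M_n(\mathbb{C})$ is simple, and it takes the same value at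
  \<open>A\<close> and at \<open>conj_mat s A\<close>: a contradiction.

  Only a two-parameter family \<open>Z a b\<close> (\<open>test_tuple\<close>) is needed to carry this out: it
  generates for all \<open>(a, b) \<noteq> (0, 0)\<close> (\<open>test_tuple_generating\<close>), and conjugation by the
  reflection \<open>s\<close> that changes the sign of the \<open>p\<close>-th basis vector takes \<open>Z a b\<close> to
  \<open>Z (- a) (- b)\<close> (\<open>conj_reflection_test_tuple\<close>), so that \<open>s\<close> fixes \<open>Z 0 0\<close>.  The
  extension reduces to the existence of the limit of \<open>\<phi> (Z 0 b)\<close> for \<open>b\<close> tending to
  \<open>0\<close> (\<open>removable_limit\<close>).  The matrix unit \<open>munit p q\<close> with \<open>q \<noteq> p\<close> changes
  sign under conjugation by \<open>s\<close>, so its image under \<open>\<phi> (Z 0 b)\<close> is odd in \<open>b\<close> and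
  tends to \<open>0\<close>.  As the identity matrix is the sum of the
  \<open>munit i p ** munit p q ** munit q i\<close>, its image, which is constantly the identity, tends to
  \<open>0\<close> as well, which is absurd.  For $d, n \ge 2$ the family exists unless $d = n = 2$: either a third matrix or a
  third index is needed to put the parameter \<open>b\<close> in a place different from that of \<open>a\<close>.
\<close>

section \<open>Matrix units and generation\<close>

text \<open>The matrix unit with entry \<open>1\<close> at \<open>(i, j)\<close>.\<close>

definition munit :: "'n \<Rightarrow> 'n \<Rightarrow> ('n::finite) cmat" where
  "munit i j = (\<chi> x y. if x = i then if y = j then 1 else 0 else 0)"

definition diagmat :: "('n \<Rightarrow> complex) \<Rightarrow> ('n::finite) cmat" where
  "diagmat f = (\<chi> x y. if x = y then f x else 0)"

lemma munit_nth: "munit i j $ x $ y = (if x = i then if y = j then 1 else 0 else 0)"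
  by (simp add: munit_def)

lemma munit_mult: "munit i j ** munit j l = munit i l"
  by (auto simp: vec_eq_iff matrix_matrix_mult_def munit_nth mult_delta_left mult_delta_right)

lemma munit_sandwich: "munit i i ** A ** munit j j = cscale (A $ i $ j) (munit i j)"
  by (auto simp: vec_eq_iff matrix_matrix_mult_def munit_nth cscale_def
      mult_delta_left mult_delta_right)

lemma mat_1_eq_sum_munit: "(mat 1 :: 'n::finite cmat) = (\<Sum>i\<in>UNIV. munit i i)"
proof -
  have "(if i = j then 1 else 0) = (\<Sum>k\<in>UNIV. if i = k then if j = k then 1 else 0 else (0::complex))"
    for i j :: 'n
    by (simp add: sum.delta')
  then show ?thesis
    by (simp add: vec_eq_iff munit_nth mat_def)
qed

lemma matrix_eq_sum_munit:
  fixes A :: "('n::finite) cmat"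
  shows "A = (\<Sum>i\<in>UNIV. \<Sum>j\<in>UNIV. cscale (A $ i $ j) (munit i j))"
proof -
  have "(\<Sum>i\<in>UNIV. \<Sum>j\<in>UNIV. A $ i $ j * munit i j $ x $ y) =
      (\<Sum>i\<in>UNIV. if x = i then \<Sum>j\<in>UNIV. if y = j then A $ i $ j else 0 else 0)" for x y
    by (intro sum.cong) (auto simp: munit_nth mult_delta_right)
  then show ?thesis
    by (simp add: vec_eq_iff cscale_def)
qed

lemma diagmat_mult: "diagmat f ** diagmat g = diagmat (\<lambda>x. f x * g x)"
  by (auto simp: vec_eq_iff matrix_matrix_mult_def diagmat_def mult_delta_left mult_delta_right)

lemma generated_algebra_zero:
  fixes z :: "('d::finite, 'n::finite) mtuple"
  shows "0 \<in> generated_algebra z"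
proof -
  have "cscale 0 (mat 1) = (0 :: 'n cmat)" by (simp add: cscale_def vec_eq_iff)
  then show ?thesis
    by (metis generated_algebra.one generated_algebra.scale)
qed

lemma generated_algebra_sum:
  "(\<And>i. i \<in> I \<Longrightarrow> f i \<in> generated_algebra z) \<Longrightarrow> sum f I \<in> generated_algebra z"
  by (induction I rule: infinite_finite_induct)
     (auto intro: generated_algebra_zero generated_algebra.add)

lemma generating_if_munits:
  assumes "\<And>i j. munit i j \<in> generated_algebra z"
  shows "z \<in> generating_tuples"
proof -
  have "A \<in> generated_algebra z" for A
    by (subst matrix_eq_sum_munit)
       (intro generated_algebra_sum generated_algebra.scale assms)
  then show ?thesis by (auto simp: generating_tuples_def)
qed

text \<open>
  By Lagrange interpolation, the polynomials in a diagonal matrix with distinct eigenvalues are all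
  the diagonal matrices.
\<close>

lemma munit_diag_in_generated_algebra:
  fixes z :: "('d::finite, 'n::finite) mtuple"
  assumes z: "z $ k = diagmat f" and f: "inj f"
  shows "munit i i \<in> generated_algebra z"
proof -
  have "diagmat (\<lambda>x. \<Prod>j\<in>S. (f x - f j) / (f i - f j)) \<in> generated_algebra z"
    if "finite S" "i \<notin> S" for S
    using that
  proof (induction S)
    case empty
    have "diagmat (\<lambda>x. 1) = (mat 1 :: 'n cmat)" by (simp add: diagmat_def mat_def)
    then show ?case by (simp add: generated_algebra.one)
  next
    case (insert j S)
    let ?c = "1 / (f i - f j)"
    have "diagmat (\<lambda>x. (f x - f j) / (f i - f j)) =
        cscale ?c (diagmat f) + cscale (- ?c * f j) (mat 1)"
      by (simp add: vec_eq_iff diagmat_def mat_def cscale_def diff_divide_distrib)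
    also have "\<dots> \<in> generated_algebra z"
      using generated_algebra.gen[of z k]
      by (intro generated_algebra.intros) (simp add: z)
    finally have "diagmat (\<lambda>x. (f x - f j) / (f i - f j)) **
        diagmat (\<lambda>x. \<Prod>j\<in>S. (f x - f j) / (f i - f j)) \<in> generated_algebra z"
      using insert by (intro generated_algebra.mult) auto
    then show ?case
      using insert.hyps by (simp add: diagmat_mult)
  qed
  from this[of "- {i}"]
  have "diagmat (\<lambda>x. \<Prod>j\<in>-{i}. (f x - f j) / (f i - f j)) \<in> generated_algebra z" by simp
  also have "diagmat (\<lambda>x. \<Prod>j\<in>-{i}. (f x - f j) / (f i - f j)) = munit i i"
  proof -
    have "(\<Prod>j\<in>-{i}. (f x - f j) / (f i - f j)) = (if x = i then 1 else 0)" for x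
    proof (cases "x = i")
      case True
      have "(\<Prod>j\<in>-{i}. (f i - f j) / (f i - f j)) = (\<Prod>j\<in>-{i}. 1)"
        using f by (intro prod.cong) (auto dest: injD)
      then show ?thesis using True by simp
    next
      case False
      then show ?thesis by (auto intro!: prod_zero)
    qed
    then show ?thesis by (auto simp: vec_eq_iff diagmat_def munit_nth)
  qed
  finally show ?thesis .
qed

text \<open>
  In the presence of a diagonal generator with distinct eigenvalues, every position at which some
  generator has a nonzero entry yields a matrix unit.
\<close>

lemma munit_in_generated_algebra:
  fixes z :: "('d::finite, 'n::finite) mtuple"
  assumes z: "z $ k = diagmat f" and f: "inj f" and nz: "z $ l $ i $ j \<noteq> 0"
  shows "munit i j \<in> generated_algebra z"
proof -
  let ?c = "z $ l $ i $ j"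
  have "munit i i ** z $ l ** munit j j \<in> generated_algebra z"
    by (intro generated_algebra.intros munit_diag_in_generated_algebra[OF z f])
  then have "cscale (1 / ?c) (cscale ?c (munit i j)) \<in> generated_algebra z"
    unfolding munit_sandwich by (rule generated_algebra.scale)
  also have "cscale (1 / ?c) (cscale ?c (munit i j)) = munit i j"
    using nz by (simp add: vec_eq_iff cscale_def)
  finally show ?thesis .
qed

section \<open>A two-parameter family of generating tuples\<close>

text \<open>
  The tuple consists of the diagonal matrix with entries \<open>f\<close> at position \<open>k0\<close>; the matrix with entries
  \<open>1\<close> off row and column \<open>p\<close> and \<open>a\<close> at \<open>(p, q)\<close> and \<open>(q, p)\<close>, at position
  \<open>k1\<close>; and the matrix with entries \<open>b\<close> at \<open>(p, r)\<close> and \<open>(r, p)\<close>, at position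
  \<open>k2\<close>.  The positions \<open>k1\<close> and \<open>k2\<close> may coincide, in which case the two matrices are
  added; all other matrices of the tuple vanish.
\<close>

definition test_tuple ::
    "('n \<Rightarrow> complex) \<Rightarrow> 'd \<Rightarrow> 'd \<Rightarrow> 'd \<Rightarrow> 'n \<Rightarrow> 'n \<Rightarrow> 'n \<Rightarrow> complex \<Rightarrow> complex
      \<Rightarrow> ('d::finite, 'n::finite) mtuple" where
  "test_tuple f k0 k1 k2 p q r a b = (\<chi> k. if k = k0 then diagmat f else
     (\<chi> i j. (if k = k1 then if i \<noteq> p \<and> j \<noteq> p then 1
                             else if (i, j) = (p, q) \<or> (i, j) = (q, p) then a else 0 else 0) +
       (if k = k2 \<and> ((i, j) = (p, r) \<or> (i, j) = (r, p)) then b else 0)))"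

lemma test_tuple_nth:
  "test_tuple f k0 k1 k2 p q r a b $ k $ i $ j = (if k = k0 then diagmat f $ i $ j else
     (if k = k1 then if i \<noteq> p \<and> j \<noteq> p then 1
                     else if (i, j) = (p, q) \<or> (i, j) = (q, p) then a else 0 else 0) +
     (if k = k2 \<and> ((i, j) = (p, r) \<or> (i, j) = (r, p)) then b else 0))"
  by (simp add: test_tuple_def)

lemma holomorphic_on_if_const:
  "f holomorphic_on S \<Longrightarrow> g holomorphic_on S \<Longrightarrow> (\<lambda>x. if c then f x else g x) holomorphic_on S"
  by (cases c) simp_all

lemma continuous_on_if_const:
  "continuous_on S f \<Longrightarrow> continuous_on S g \<Longrightarrow> continuous_on S (\<lambda>x. if c then f x else g x)"
  by (cases c) simp_all

text \<open>
  The nonzero entries form a strongly connected graph on the indices: those different from \<open>p\<close>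
  are joined to each other, and \<open>p\<close> is joined to \<open>q\<close> if \<open>a \<noteq> 0\<close> and to \<open>r\<close> if
  \<open>b \<noteq> 0\<close>.  The condition on \<open>(k1, q)\<close> and \<open>(k2, r)\<close> prevents the cancellation of
  \<open>a\<close> against \<open>b\<close>.
\<close>

lemma test_tuple_generating:
  fixes k0 k1 k2 :: "'d::finite" and p q r :: "'n::finite"
  assumes f: "inj f" and k: "k1 \<noteq> k0" "k2 \<noteq> k0" and pq: "q \<noteq> p" "r \<noteq> p"
    and ne: "(k1, q) \<noteq> (k2, r)" and ab: "(a, b) \<noteq> (0, 0)"
  shows "test_tuple f k0 k1 k2 p q r a b \<in> generating_tuples"
proof -
  define z where "z = test_tuple f k0 k1 k2 p q r a b"
  have z0: "z $ k0 = diagmat f"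
    by (simp add: z_def test_tuple_def)
  note unit = munit_in_generated_algebra[OF z0 f]
  have 1: "munit i j \<in> generated_algebra z" if "i \<noteq> p" "j \<noteq> p" for i j
    by (rule unit[of k1]) (use that k in \<open>auto simp: z_def test_tuple_def\<close>)
  obtain m where m: "m \<noteq> p" "munit p m \<in> generated_algebra z" "munit m p \<in> generated_algebra z"
  proof (cases "a = 0")
    case False
    then show ?thesis
      using k pq ne that[of q] unit[of k1 p q] unit[of k1 q p]
      by (auto simp: z_def test_tuple_def)
  next
    case True
    then show ?thesis
      using k pq ne ab that[of r] unit[of k2 p r] unit[of k2 r p]
      by (auto simp: z_def test_tuple_def)
  qed
  have 2: "munit p j \<in> generated_algebra z" "munit j p \<in> generated_algebra z" if "j \<noteq> p" for j
    using generated_algebra.mult[OF m(2) 1[OF m(1) that]]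
      generated_algebra.mult[OF 1[OF that m(1)] m(3)] by (simp_all add: munit_mult)
  have "munit i j \<in> generated_algebra z" for i j
    using 1 2 munit_diag_in_generated_algebra[OF z0 f] by metis
  then show ?thesis
    using generating_if_munits z_def by blast
qed

text \<open>The reflection that changes the sign of the basis vector with index \<open>p\<close>.\<close>

definition reflection :: "'n \<Rightarrow> ('n::finite) cmat" where
  "reflection p = diagmat (\<lambda>i. if i = p then - 1 else 1)"

lemma reflection_mult_self: "reflection p ** reflection p = mat 1"
  by (simp add: reflection_def diagmat_mult) (simp add: diagmat_def mat_def vec_eq_iff)

lemma conj_reflection_nth:
  "conj_mat (reflection p) A $ i $ j = (if (i = p) = (j = p) then A $ i $ j else - A $ i $ j)"
  unfolding conj_mat_def matrix_inv_eqI[OF reflection_mult_self]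
  by (auto simp: reflection_def diagmat_def matrix_matrix_mult_def mult_delta_left mult_delta_right)

lemma conj_reflection_test_tuple:
  assumes "k1 \<noteq> k0" "k2 \<noteq> k0" "q \<noteq> p" "r \<noteq> p"
  shows "conj_tuple (reflection p) (test_tuple f k0 k1 k2 p q r a b) =
    test_tuple f k0 k1 k2 p q r (- a) (- b)"
  using assms by (auto simp: vec_eq_iff conj_tuple_def conj_reflection_nth test_tuple_def diagmat_def)

section \<open>Holomorphic functions on the punctured plane\<close>

text \<open>
  The part of Hartogs' theorem on the isolated point of the plane that is used here.  By the maximum
  principle on the disc \<open>cball 0 1\<close> in the first variable, \<open>F 0 b - F 0 c\<close> is bounded by the
  values of \<open>F a b - F a c\<close> on the circle, away from the singularity, where \<open>F\<close> is
  uniformly continuous.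
\<close>

lemma removable_limit:
  fixes F :: "complex \<Rightarrow> complex \<Rightarrow> complex"
  assumes cont: "continuous_on (- {(0, 0)}) (\<lambda>(a, b). F a b)"
    and hol: "\<And>b. b \<noteq> 0 \<Longrightarrow> (\<lambda>a. F a b) holomorphic_on UNIV"
  obtains L where "(F 0 \<longlongrightarrow> L) (at 0)"
proof -
  let ?X = "ball 0 1 - {0 :: complex}"
  have "compact (sphere (0::complex) 1 \<times> cball (0::complex) 1)"
    by (intro compact_Times) auto
  moreover have "continuous_on (sphere 0 1 \<times> cball 0 1) (\<lambda>(a, b). F a b)"
    by (rule continuous_on_subset[OF cont]) auto
  ultimately have unif: "uniformly_continuous_on (sphere 0 1 \<times> cball 0 1) (\<lambda>(a, b). F a b)"
    by (simp add: compact_uniformly_continuous)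
  have "uniformly_continuous_on ?X (F 0)"
    unfolding uniformly_continuous_on_def
  proof (intro allI impI)
    fix e :: real assume "e > 0"
    then obtain d where d: "d > 0" and
      D: "\<And>x y. x \<in> sphere 0 1 \<times> cball 0 1 \<Longrightarrow> y \<in> sphere 0 1 \<times> cball 0 1 \<Longrightarrow> dist y x < d \<Longrightarrow>
        dist (case_prod F y) (case_prod F x) < e / 2"
      using unif[unfolded uniformly_continuous_on_def, rule_format, of "e / 2"] by force
    have "dist (F 0 c) (F 0 b) < e" if b: "b \<in> ?X" and c: "c \<in> ?X" and "dist c b < d" for b c
    proof -
      have hol': "(\<lambda>a. F a c - F a b) holomorphic_on UNIV"
        using b c by (intro holomorphic_intros hol) auto
      have "norm (F 0 c - F 0 b) \<le> e / 2"
      proof (rule maximum_modulus_frontier[of "\<lambda>a. F a c - F a b" "cball 0 1"])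
        show "(\<lambda>a. F a c - F a b) holomorphic_on interior (cball 0 1)"
          using hol' by (rule holomorphic_on_subset) simp
        show "continuous_on (closure (cball 0 1)) (\<lambda>a. F a c - F a b)"
          using hol' holomorphic_on_imp_continuous_on continuous_on_subset by blast
        fix a :: complex assume "a \<in> frontier (cball 0 1)"
        then show "norm (F a c - F a b) \<le> e / 2"
          using D[of "(a, b)" "(a, c)"] that b c by (auto simp: dist_norm norm_Pair)
      qed auto
      then show ?thesis using \<open>e > 0\<close> by (simp add: dist_norm)
    qed
    then show "\<exists>d>0. \<forall>x\<in>?X. \<forall>x'\<in>?X. dist x' x < d \<longrightarrow> dist (F 0 x') (F 0 x) < e"
      using d by blast
  qed
  moreover have "(0::complex) \<in> closure ?X"
    unfolding islimpt_in_closure[symmetric] by (intro interior_limit_point) simp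
  ultimately obtain L where "(F 0 \<longlongrightarrow> L) (at 0 within ?X)"
    by (rule uniformly_continuous_on_extension_at_closure)
  moreover have "at 0 within ?X = at (0::complex)"
    using at_within_open[of "0::complex" "ball 0 1"] by (simp add: at_within_def)
  ultimately show ?thesis using that by simp
qed

section \<open>Coordinate spaces and their holomorphic functions\<close>

text \<open>The chain rule for a holomorphic function of several variables along a complex curve.\<close>

lemma hol_on_CI_compose_curve:
  assumes I: "finite I" and F: "hol_on_CI I W F"
    and W: "eval_at I (\<gamma> a0) \<in> W"
    and \<gamma>: "\<And>\<phi>. \<phi> \<in> I \<Longrightarrow> (\<lambda>a. \<phi> (\<gamma> a)) field_differentiable at a0"
  shows "eventually (\<lambda>a. eval_at I (\<gamma> a) \<in> W) (at a0)"
    and "(\<lambda>a. F (eval_at I (\<gamma> a))) field_differentiable at a0"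
proof -
  have "openin (product_topology (\<lambda>_. euclidean) I) W"
    using F by (simp add: hol_on_CI_def)
  then obtain X where X: "eval_at I (\<gamma> a0) \<in> (\<Pi>\<^sub>E \<phi>\<in>I. X \<phi>)" "\<And>\<phi>. open (X \<phi>)"
    "(\<Pi>\<^sub>E \<phi>\<in>I. X \<phi>) \<subseteq> W"
    using product_topology_open_contains_basis[of "\<lambda>_. euclidean" I W "eval_at I (\<gamma> a0)"] W by auto
  have "eventually (\<lambda>a. \<phi> (\<gamma> a) \<in> X \<phi>) (at a0)" if "\<phi> \<in> I" for \<phi>
  proof -
    have "((\<lambda>a. \<phi> (\<gamma> a)) \<longlongrightarrow> \<phi> (\<gamma> a0)) (at a0)"
      using \<gamma>[OF that] field_differentiable_imp_continuous_at isContD by blast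
    then show ?thesis
      using X(1,2) that by (intro topological_tendstoD) (auto simp: eval_at_def PiE_iff)
  qed
  then have "eventually (\<lambda>a. \<forall>\<phi>\<in>I. \<phi> (\<gamma> a) \<in> X \<phi>) (at a0)"
    by (simp add: I eventually_ball_finite)
  then show ev: "eventually (\<lambda>a. eval_at I (\<gamma> a) \<in> W) (at a0)"
    by eventually_elim (use X(3) in \<open>auto simp: eval_at_def PiE_iff\<close>)
  obtain c where c: "\<And>\<phi>. \<phi> \<in> I \<Longrightarrow> ((\<lambda>a. \<phi> (\<gamma> a)) has_field_derivative c \<phi>) (at a0)"
    using \<gamma> unfolding field_differentiable_def by metis
  define w where "w = eval_at I (\<gamma> a0)"
  have quot: "((\<lambda>a. (\<phi> (\<gamma> a) - \<phi> (\<gamma> a0)) / (a - a0)) \<longlongrightarrow> c \<phi>) (at a0)" if "\<phi> \<in> I" for \<phi>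
    using c[OF that] by (simp add: has_field_derivative_iff)
  obtain l where l: "\<And>\<epsilon>. \<epsilon> > 0 \<Longrightarrow> \<exists>\<delta>>0. \<forall>v \<in> W. (\<forall>i\<in>I. cmod (v i - w i) < \<delta>) \<longrightarrow>
      cmod (F v - F w - (\<Sum>i\<in>I. l i * (v i - w i))) \<le> \<epsilon> * (\<Sum>i\<in>I. cmod (v i - w i))"
    using bspec[OF conjunct2[OF F[unfolded hol_on_CI_def]] W] unfolding w_def[symmetric]
    by (elim exE) (meson that)
  \<comment> \<open>the remainder of the first-order expansion of \<open>F\<close>, divided by \<open>a - a0\<close>\<close>
  define R where "R a = (F (eval_at I (\<gamma> a)) - F w -
      (\<Sum>\<phi>\<in>I. l \<phi> * (\<phi> (\<gamma> a) - \<phi> (\<gamma> a0)))) / (a - a0)" for a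
  have "(R \<longlongrightarrow> 0) (at a0)"
  proof (rule tendstoI)
    fix e :: real assume e: "e > 0"
    define K where "K = (\<Sum>\<phi>\<in>I. cmod (c \<phi>) + 1)"
    have K: "K \<ge> 0" by (auto simp: K_def intro!: sum_nonneg)
    define \<epsilon> where "\<epsilon> = e / (K + 1)"
    have \<epsilon>: "\<epsilon> > 0" using e K by (simp add: \<epsilon>_def)
    obtain \<delta> where \<delta>: "\<delta> > 0" and le: "\<And>v. v \<in> W \<Longrightarrow> (\<forall>i\<in>I. cmod (v i - w i) < \<delta>) \<Longrightarrow>
        cmod (F v - F w - (\<Sum>i\<in>I. l i * (v i - w i))) \<le> \<epsilon> * (\<Sum>i\<in>I. cmod (v i - w i))"
      using l[OF \<epsilon>] by blast
    have "eventually (\<lambda>a. cmod (\<phi> (\<gamma> a) - \<phi> (\<gamma> a0)) < \<delta>) (at a0)" if "\<phi> \<in> I" for \<phi>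
    proof -
      have "((\<lambda>a. \<phi> (\<gamma> a)) \<longlongrightarrow> \<phi> (\<gamma> a0)) (at a0)"
        using \<gamma>[OF that] field_differentiable_imp_continuous_at isContD by blast
      from tendstoD[OF this \<delta>] show ?thesis by (simp add: dist_norm)
    qed
    then have 1: "eventually (\<lambda>a. \<forall>\<phi>\<in>I. cmod (\<phi> (\<gamma> a) - \<phi> (\<gamma> a0)) < \<delta>) (at a0)"
      by (simp add: I eventually_ball_finite)
    have "eventually (\<lambda>a. cmod ((\<phi> (\<gamma> a) - \<phi> (\<gamma> a0)) / (a - a0)) < cmod (c \<phi>) + 1) (at a0)"
      if "\<phi> \<in> I" for \<phi>
      by (rule order_tendstoD(2)[OF tendsto_norm[OF quot[OF that]]]) simp
    then have 2: "eventually (\<lambda>a. \<forall>\<phi>\<in>I.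
        cmod ((\<phi> (\<gamma> a) - \<phi> (\<gamma> a0)) / (a - a0)) < cmod (c \<phi>) + 1) (at a0)"
      by (simp add: I eventually_ball_finite)
    have 3: "eventually (\<lambda>a. a \<noteq> a0) (at a0)"
      by (simp add: eventually_at_filter)
    from ev 1 2 3 show "eventually (\<lambda>a. dist (R a) 0 < e) (at a0)"
    proof eventually_elim
      case (elim a)
      have v: "eval_at I (\<gamma> a) \<phi> - w \<phi> = \<phi> (\<gamma> a) - \<phi> (\<gamma> a0)" if "\<phi> \<in> I" for \<phi>
        using that by (simp add: eval_at_def w_def)
      have "cmod (F (eval_at I (\<gamma> a)) - F w - (\<Sum>\<phi>\<in>I. l \<phi> * (\<phi> (\<gamma> a) - \<phi> (\<gamma> a0))))
          \<le> \<epsilon> * (\<Sum>\<phi>\<in>I. cmod (\<phi> (\<gamma> a) - \<phi> (\<gamma> a0)))"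
        using le[OF elim(1)] elim(2) by (simp add: v cong: sum.cong)
      then have "cmod (R a) \<le> \<epsilon> * (\<Sum>\<phi>\<in>I. cmod (\<phi> (\<gamma> a) - \<phi> (\<gamma> a0))) / cmod (a - a0)"
        by (simp add: R_def norm_divide divide_right_mono)
      also have "\<dots> = \<epsilon> * (\<Sum>\<phi>\<in>I. cmod ((\<phi> (\<gamma> a) - \<phi> (\<gamma> a0)) / (a - a0)))"
        by (simp add: norm_divide flip: sum_divide_distrib)
      also have "\<dots> \<le> \<epsilon> * K"
        unfolding K_def using elim(3) \<epsilon> by (intro mult_left_mono sum_mono) (auto intro: less_imp_le)
      also have "\<dots> < e"
        using e K by (simp add: \<epsilon>_def field_simps)
      finally show ?case by simp
    qed
  qed
  then have "((\<lambda>a. R a + (\<Sum>\<phi>\<in>I. l \<phi> * ((\<phi> (\<gamma> a) - \<phi> (\<gamma> a0)) / (a - a0)))) \<longlongrightarrow>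
      0 + (\<Sum>\<phi>\<in>I. l \<phi> * c \<phi>)) (at a0)"
    by (intro tendsto_intros quot)
  also have "(\<lambda>a. R a + (\<Sum>\<phi>\<in>I. l \<phi> * ((\<phi> (\<gamma> a) - \<phi> (\<gamma> a0)) / (a - a0)))) =
      (\<lambda>a. (F (eval_at I (\<gamma> a)) - F w) / (a - a0))"
    by (simp add: R_def fun_eq_iff flip: sum_divide_distrib add_divide_distrib)
  finally show "(\<lambda>a. F (eval_at I (\<gamma> a))) field_differentiable at a0"
    unfolding field_differentiable_def has_field_derivative_iff w_def by blast
qed

lemma hol_generated_compose_curve:
  assumes h: "hol_generated \<Phi> U h" and U: "\<And>a. \<gamma> a \<in> U"
    and \<gamma>: "\<And>\<phi>. \<phi> \<in> \<Phi> \<Longrightarrow> (\<lambda>a. \<phi> (\<gamma> a)) holomorphic_on UNIV"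
  shows "(\<lambda>a. h (\<gamma> a)) holomorphic_on UNIV"
proof -
  have "(\<lambda>a. h (\<gamma> a)) field_differentiable at a0" for a0
  proof -
    obtain I W F where I: "finite I" "I \<subseteq> \<Phi>" and F: "hol_on_CI I W F" and W: "eval_at I (\<gamma> a0) \<in> W"
      and eq: "\<And>y. y \<in> U \<Longrightarrow> eval_at I y \<in> W \<Longrightarrow> h y = F (eval_at I y)"
      using h U unfolding hol_generated_def by meson
    have diff: "(\<lambda>a. \<phi> (\<gamma> a)) field_differentiable at a0" if "\<phi> \<in> I" for \<phi>
      using \<gamma>[of \<phi>] I(2) that by (auto simp: holomorphic_on_def)
    have "eventually (\<lambda>a. eval_at I (\<gamma> a) \<in> W) (at a0)"
      by (rule hol_on_CI_compose_curve(1)) (use I F W diff in auto)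
    then have "eventually (\<lambda>a. F (eval_at I (\<gamma> a)) = h (\<gamma> a)) (at a0)"
      by eventually_elim (simp add: eq U)
    moreover have "(\<lambda>a. F (eval_at I (\<gamma> a))) field_differentiable at a0"
      by (rule hol_on_CI_compose_curve(2)) (use I F W diff in auto)
    moreover have "F (eval_at I (\<gamma> a0)) = h (\<gamma> a0)"
      using W by (simp add: eq U)
    ultimately show ?thesis
      using has_field_derivative_cong_eventually[of "\<lambda>a. F (eval_at I (\<gamma> a))" "\<lambda>a. h (\<gamma> a)"]
      unfolding field_differentiable_def by blast
  qed
  then show ?thesis by (simp add: holomorphic_on_def)
qed

lemma continuous_map_coord_space:
  assumes "\<And>x. x \<in> topspace T \<Longrightarrow> g x \<in> S"
    and "\<And>\<phi>. \<phi> \<in> \<Phi> \<Longrightarrow> continuous_map T euclidean (\<lambda>x. \<phi> (g x))"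
  shows "continuous_map T (topo (coord_space S \<Phi>)) g"
  unfolding coord_space_def
  using assms
  by (auto intro!: continuous_map_pullback' simp: continuous_map_componentwise eval_at_def o_def)

lemma continuous_map_coordinate:
  assumes "\<phi> \<in> \<Phi>"
  shows "continuous_map (topo (coord_space S \<Phi>)) euclidean \<phi>"
proof -
  have "continuous_map (product_topology (\<lambda>_. euclidean) \<Phi>) euclidean (\<lambda>x. x \<phi>)"
    using assms by (rule continuous_map_product_projection)
  then have "continuous_map (topo (coord_space S \<Phi>)) euclidean ((\<lambda>x. x \<phi>) \<circ> eval_at \<Phi>)"
    unfolding coord_space_def by auto
  then show ?thesis using assms by (simp add: eval_at_def o_def)
qed

lemma hol_generated_coordinate:
  assumes "\<phi> \<in> \<Phi>"
  shows "hol_generated \<Phi> U \<phi>"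
proof -
  have "hol_on_CI {\<phi>} (topspace (product_topology (\<lambda>_. euclidean) {\<phi>})) (\<lambda>v. v \<phi>)"
    unfolding hol_on_CI_def by (intro conjI openin_topspace) (auto intro!: exI[of _ "\<lambda>_. 1"] exI[of _ 1])
  then show ?thesis
    unfolding hol_generated_def using assms
    by (intro ballI exI[of _ "{\<phi>}"] exI[of _ "topspace (product_topology (\<lambda>_. euclidean) {\<phi>})"]
        exI[of _ "\<lambda>v. v \<phi>"]) (auto simp: eval_at_def)
qed

lemma continuous_map_quotient_cspace:
  "continuous_map (topo X) (topo (quotient_cspace X R)) (\<lambda>x. R `` {x})"
  by (auto simp: continuous_map_def openin_quotient_cspace quotientI)

lemma topspace_VM_space: "points VM_space = generating_tuples \<times> UNIV"
  by (simp add: VM_space_def)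

section \<open>The fibre maps of a trivialization\<close>

context
  fixes \<Psi> :: "('d::finite, 'n::finite) mpoint \<Rightarrow> ('d, 'n) qpoint \<times> 'n cmat"
  assumes iso: "algebra_bundle_iso matrix_bundle (product_bundle Q0_space) \<Psi>"
begin

text \<open>
  The trivialization sends \<open>[z, A]\<close> to a pair with first component \<open>\<pi>\<^sub>0 z\<close>; the fibre map at
  \<open>z\<close> takes \<open>A\<close> to the second component.
\<close>

definition fibre_map :: "('d, 'n) mtuple \<Rightarrow> 'n cmat \<Rightarrow> 'n cmat" where
  "fibre_map z A = snd (\<Psi> (orbit_rel `` {(z, A)}))"

lemma orbit_in_total:
  assumes "z \<in> generating_tuples"
  shows "orbit_rel `` {(z, A)} \<in> points (total (matrix_bundle :: (('d, 'n) mpoint, ('d, 'n) qpoint) algebra_bundle))"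
  using assms by (auto simp: matrix_bundle_def topspace_VM_space intro: quotientI)

lemma trivialization_orbit:
  assumes "z \<in> generating_tuples"
  shows "\<Psi> (orbit_rel `` {(z, A)}) = (\<pi>\<^sub>0 z, fibre_map z A)"
proof -
  have "fst (\<Psi> (orbit_rel `` {(z, A)})) = \<pi>\<^sub>0 z"
    using iso orbit_in_total[OF assms] bproj_orbit[OF assms]
    by (auto simp: algebra_bundle_iso_def product_bundle_def)
  then show ?thesis by (simp add: fibre_map_def prod_eq_iff)
qed

lemma fibre_map_add:
  assumes z: "z \<in> generating_tuples"
  shows "fibre_map z (A + B) = fibre_map z A + fibre_map z B"
proof -
  have "\<Psi> (fadd matrix_bundle (orbit_rel `` {(z, A)}) (orbit_rel `` {(z, B)})) =
      fadd (product_bundle Q0_space) (\<Psi> (orbit_rel `` {(z, A)})) (\<Psi> (orbit_rel `` {(z, B)}))"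
    using iso orbit_in_total[OF z] bproj_orbit[OF z] unfolding algebra_bundle_iso_def by metis
  then show ?thesis
    by (simp add: fadd_orbit trivialization_orbit z product_bundle_def)
qed

lemma fibre_map_mult:
  assumes z: "z \<in> generating_tuples"
  shows "fibre_map z (A ** B) = fibre_map z A ** fibre_map z B"
proof -
  have "\<Psi> (fmul matrix_bundle (orbit_rel `` {(z, A)}) (orbit_rel `` {(z, B)})) =
      fmul (product_bundle Q0_space) (\<Psi> (orbit_rel `` {(z, A)})) (\<Psi> (orbit_rel `` {(z, B)}))"
    using iso orbit_in_total[OF z] bproj_orbit[OF z] unfolding algebra_bundle_iso_def by metis
  then show ?thesis
    by (simp add: fmul_orbit trivialization_orbit z product_bundle_def)
qed

lemma fibre_map_cscale:
  assumes z: "z \<in> generating_tuples"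
  shows "fibre_map z (cscale c A) = cscale c (fibre_map z A)"
proof -
  have "\<Psi> (fscale matrix_bundle c (orbit_rel `` {(z, A)})) =
      fscale (product_bundle Q0_space) c (\<Psi> (orbit_rel `` {(z, A)}))"
    using iso orbit_in_total[OF z] unfolding algebra_bundle_iso_def by metis
  then show ?thesis
    by (simp add: fscale_orbit trivialization_orbit z product_bundle_def)
qed

lemma fibre_map_conj:
  assumes "z \<in> generating_tuples" "invertible s"
  shows "fibre_map (conj_tuple s z) (conj_mat s A) = fibre_map z A"
proof -
  have "((z, A), (conj_tuple s z, conj_mat s A)) \<in> orbit_rel"
    using assms by (auto simp: orbit_rel_def)
  then have "orbit_rel `` {(conj_tuple s z, conj_mat s A)} = orbit_rel `` {(z, A)}"
    using equiv_class_eq[OF equiv_orbit_rel] by metis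
  then show ?thesis by (simp add: fibre_map_def)
qed

text \<open>Injectivity holds because the stabilizer of a generating tuple acts trivially on matrices.\<close>

lemma inj_fibre_map:
  assumes z: "z \<in> generating_tuples"
  shows "inj (fibre_map z)"
proof (rule injI)
  fix A B assume "fibre_map z A = fibre_map z B"
  then have "\<Psi> (orbit_rel `` {(z, A)}) = \<Psi> (orbit_rel `` {(z, B)})"
    by (simp add: trivialization_orbit z)
  then have "orbit_rel `` {(z, A)} = orbit_rel `` {(z, B)}"
    using iso orbit_in_total[OF z] unfolding algebra_bundle_iso_def biholomorphic_map_def by metis
  moreover have "(z, B) \<in> points VM_space" using z by (simp add: topspace_VM_space)
  ultimately have "((z, A), (z, B)) \<in> orbit_rel"
    using eq_equiv_class[OF _ equiv_orbit_rel] by blast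
  then obtain s where s: "invertible s" "conj_tuple s z = z" "B = conj_mat s A"
    by (auto simp: orbit_rel_def)
  moreover have "invertible (mat 1 :: 'n cmat)" by (simp add: invertible_def)
  moreover have "conj_tuple (mat 1) z = z" by (simp add: conj_tuple_def conj_mat_id)
  ultimately show "A = B"
    using conj_tuple_eq_imp_conj_mat_eq[OF z s(1), of "mat 1" A] by (simp add: conj_mat_id)
qed

text \<open>
  Surjectivity of the fibre map is derived from injectivity by counting dimensions; deriving it from
  the surjectivity of \<open>\<Psi>\<close> would require that generating tuples with the same invariants be
  conjugate.
\<close>

lemma fibre_map_one:
  assumes z: "z \<in> generating_tuples"
  shows "fibre_map z (mat 1) = mat 1"
proof -
  have scaleR: "r *\<^sub>R A = cscale (of_real r) A" for r and A :: "'n cmat"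
    by (simp add: cscale_def vec_eq_iff scaleR_conv_of_real[where 'a = complex])
  have "linear (fibre_map z)"
    by (rule linearI) (simp_all add: fibre_map_add fibre_map_cscale z scaleR)
  then have "surj (fibre_map z)"
    using inj_fibre_map[OF z] linear_injective_imp_surjective by blast
  then obtain A where A: "fibre_map z A = mat 1" by (metis surjD)
  have "fibre_map z (mat 1) = fibre_map z (mat 1) ** fibre_map z A" by (simp add: A)
  also have "\<dots> = fibre_map z A" by (simp add: fibre_map_mult[OF z, symmetric])
  finally show ?thesis by (simp add: A)
qed

lemma fibre_map_entry_continuous:
  assumes "continuous_on S \<gamma>" "\<And>x. x \<in> S \<Longrightarrow> \<gamma> x \<in> generating_tuples"
  shows "continuous_on S (\<lambda>x. fibre_map (\<gamma> x) A $ i $ j)"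
proof -
  let ?T = "top_of_set S"
  have 1: "continuous_map ?T (topo VM_space) (\<lambda>x. (\<gamma> x, A))"
    unfolding VM_space_def using assms
    by (intro continuous_map_coord_space) (auto intro!: continuous_intros)
  have 2: "continuous_map (topo VM_space) (prod_topology (topo Q0_space) (topo matrix_space))
      (\<lambda>x. \<Psi> (orbit_rel `` {x}))"
    using iso continuous_map_compose[OF continuous_map_quotient_cspace[of VM_space orbit_rel], of _ \<Psi>]
    by (auto simp: algebra_bundle_iso_def biholomorphic_map_def holomorphic_map_def
        matrix_bundle_def product_bundle_def prod_cspace_def o_def)
  have 3: "continuous_map (topo matrix_space) euclidean (\<lambda>A :: 'n cmat. A $ i $ j)"
    unfolding matrix_space_def by (rule continuous_map_coordinate) auto
  have "continuous_map ?T euclidean (\<lambda>x. snd (\<Psi> (orbit_rel `` {(\<gamma> x, A)})) $ i $ j)"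
    using continuous_map_compose[OF 1 continuous_map_compose[OF 2
        continuous_map_compose[OF continuous_map_snd 3]]]
    by (simp add: o_def)
  then show ?thesis by (simp add: fibre_map_def)
qed

text \<open>
  An entry of the matrix component is holomorphic on the total space of the product bundle; its
  pullback along \<open>\<Psi>\<close> is holomorphic on the quotient, which by definition of the quotient structure
  is a statement about functions on pairs \<open>(z, A)\<close>.
\<close>

lemma fibre_map_entry_hol:
  "hol_generated (range (\<lambda>(k, i, j) (z, A). z $ k $ i $ j) \<union> range (\<lambda>(i, j) (z, A). A $ i $ j))
     (generating_tuples \<times> UNIV) (\<lambda>(z, A). fibre_map z A $ i $ j)"
proof -
  define h :: "('d, 'n) qpoint \<times> 'n cmat \<Rightarrow> complex" where "h = (\<lambda>A. A $ i $ j) \<circ> snd"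
  let ?Q = "points (Q0_space :: ('d, 'n) qpoint cspace)"
  let ?M = "points (matrix_space :: 'n cmat cspace)"
  have "(\<lambda>A :: 'n cmat. A $ i $ j) \<in> hol matrix_space ?M"
    by (auto simp: matrix_space_def coord_space_def intro!: hol_generated_coordinate)
  then have "hol_generated ((\<lambda>g. g \<circ> fst) ` hol Q0_space ?Q \<union> (\<lambda>g. g \<circ> snd) ` hol matrix_space ?M)
      (?Q \<times> ?M) h"
    unfolding h_def by (intro hol_generated_coordinate) blast
  then have "h \<in> hol (prod_cspace Q0_space matrix_space) (?Q \<times> ?M)"
    unfolding prod_cspace_def by auto
  moreover have "openin (topo (prod_cspace Q0_space matrix_space)) (?Q \<times> ?M)"
    by (simp add: prod_cspace_def openin_prod_Times_iff)
  moreover have hm: "holomorphic_map (quotient_cspace VM_space orbit_rel)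
      (prod_cspace Q0_space matrix_space) \<Psi>"
    using iso by (simp add: algebra_bundle_iso_def biholomorphic_map_def matrix_bundle_def
        product_bundle_def)
  moreover have "\<Psi> x \<in> ?Q \<times> ?M" if "x \<in> points (quotient_cspace VM_space orbit_rel)" for x
    using hm that unfolding holomorphic_map_def continuous_map_def
    by (auto simp: prod_cspace_def)
  ultimately have "h \<circ> \<Psi> \<in> hol (quotient_cspace VM_space orbit_rel)
      (points (quotient_cspace VM_space orbit_rel))"
    unfolding holomorphic_map_def by (metis (no_types, lifting) Collect_cong Collect_mem_eq)
  then have "(\<lambda>x. h (\<Psi> (orbit_rel `` {x}))) \<in>
      hol VM_space {x \<in> points VM_space. orbit_rel `` {x} \<in> points VM_space // orbit_rel}"
    unfolding topspace_quotient_cspace by (simp add: quotient_cspace_def o_def)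
  also have "{x \<in> points VM_space. orbit_rel `` {x} \<in> points VM_space // orbit_rel} =
      (generating_tuples \<times> UNIV :: (('d, 'n) mtuple \<times> 'n cmat) set)"
    by (auto simp: topspace_VM_space intro: quotientI)
  finally show ?thesis
    by (simp add: VM_space_def coord_space_def h_def fibre_map_def case_prod_beta' cong: image_cong)
qed

lemma fibre_map_entry_holomorphic_on:
  assumes "\<And>a. \<gamma> a \<in> generating_tuples"
    and "\<And>k i j. (\<lambda>a. \<gamma> a $ k $ i $ j) holomorphic_on UNIV"
  shows "(\<lambda>a. fibre_map (\<gamma> a) A $ i $ j) holomorphic_on UNIV"
proof -
  have "(\<lambda>a. (\<lambda>(z, A). fibre_map z A $ i $ j) (\<gamma> a, A)) holomorphic_on UNIV"
    by (rule hol_generated_compose_curve[OF fibre_map_entry_hol]) (use assms in auto)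
  then show ?thesis by simp
qed

section \<open>The contradiction\<close>

text \<open>
  The existence of the test family contradicts the existence of the trivialization \<open>\<Psi>\<close>.
\<close>

lemma no_trivialization:
  fixes k0 k1 k2 :: 'd and p q r :: 'n
  assumes k: "k1 \<noteq> k0" "k2 \<noteq> k0" and pq: "q \<noteq> p" "r \<noteq> p" and ne: "(k1, q) \<noteq> (k2, r)"
  shows False
proof -
  obtain f :: "'n \<Rightarrow> nat" where "inj f"
    using finite_imp_inj_to_nat_seg[of "UNIV :: 'n set"] by auto
  then have f: "inj (\<lambda>i. of_nat (f i) :: complex)" by (auto simp: inj_def)
  define Z :: "complex \<Rightarrow> complex \<Rightarrow> ('d, 'n) mtuple" where
    "Z = test_tuple (\<lambda>i. of_nat (f i)) k0 k1 k2 p q r"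
  have gen: "Z a b \<in> generating_tuples" if "(a, b) \<noteq> (0, 0)" for a b
    unfolding Z_def by (rule test_tuple_generating[OF f k pq ne that])
  have refl: "invertible (reflection p)"
    using reflection_mult_self[of p] by (auto simp: invertible_def)
  have "\<exists>L. ((\<lambda>b. fibre_map (Z 0 b) A $ i $ j) \<longlongrightarrow> L) (at 0)" for A i j
  proof (rule removable_limit)
    have "continuous_on (- {(0, 0)}) (\<lambda>x. Z (fst x) (snd x))"
      unfolding Z_def test_tuple_def by (intro continuous_intros continuous_on_if_const)
    then show "continuous_on (- {(0, 0)}) (\<lambda>(a, b). fibre_map (Z a b) A $ i $ j)"
      unfolding case_prod_beta' by (rule fibre_map_entry_continuous) (auto intro!: gen)
    show "(\<lambda>a. fibre_map (Z a b) A $ i $ j) holomorphic_on UNIV" if "b \<noteq> 0" for b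
    proof (rule fibre_map_entry_holomorphic_on)
      show "(\<lambda>a. Z a b $ k $ i $ j) holomorphic_on UNIV" for k i j
        unfolding Z_def test_tuple_nth by (intro holomorphic_intros holomorphic_on_if_const)
    qed (use that gen in auto)
  qed blast
  then obtain L where L: "\<And>A i j. ((\<lambda>b. fibre_map (Z 0 b) A $ i $ j) \<longlongrightarrow> L A i j) (at 0)"
    by metis
  \<comment> \<open>the image of \<open>munit p q\<close> is odd in \<open>b\<close>\<close>
  have L0: "L (munit p q) i j = 0" for i j
  proof -
    let ?g = "\<lambda>b. fibre_map (Z 0 b) (munit p q) $ i $ j"
    have "?g (- b) = - ?g b" if "b \<noteq> 0" for b
    proof -
      have "conj_tuple (reflection p) (Z 0 b) = Z 0 (- b)"
        using conj_reflection_test_tuple[OF k pq] by (simp add: Z_def)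
      moreover have "conj_mat (reflection p) (munit p q) = cscale (- 1) (munit p q)"
        using pq by (simp add: vec_eq_iff conj_reflection_nth munit_nth cscale_def)
      ultimately have "cscale (- 1) (fibre_map (Z 0 (- b)) (munit p q)) = fibre_map (Z 0 b) (munit p q)"
        using fibre_map_conj[OF gen refl, of 0 b "munit p q"] fibre_map_cscale[OF gen, of 0 "- b"] that
        by simp
      from arg_cong[OF this, of "\<lambda>A. A $ i $ j"] show ?thesis
        by (simp add: cscale_def minus_equation_iff)
    qed
    then have ev: "eventually (\<lambda>b. ?g (- b) = - ?g b) (at 0)"
      by (simp add: eventually_at_filter)
    have "filterlim uminus (at 0) (at (0::complex))"
      using filtermap_at_minus[of "0::complex"] by (simp add: filterlim_def)
    from filterlim_compose[OF L this]
    have "((\<lambda>b. ?g (- b)) \<longlongrightarrow> L (munit p q) i j) (at 0)" .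
    then have "((\<lambda>b. - ?g b) \<longlongrightarrow> L (munit p q) i j) (at 0)"
      using tendsto_cong[OF ev] by blast
    from tendsto_unique[OF _ this tendsto_minus[OF L]] show ?thesis by simp
  qed
  have "((\<lambda>b. \<Sum>i\<in>UNIV. (fibre_map (Z 0 b) (munit i p) ** fibre_map (Z 0 b) (munit p q) **
      fibre_map (Z 0 b) (munit q i)) $ p $ p) \<longlongrightarrow>
      (\<Sum>i\<in>UNIV. \<Sum>x\<in>UNIV. (\<Sum>y\<in>UNIV. L (munit i p) p y * L (munit p q) y x) * L (munit q i) x p)) (at 0)"
    unfolding matrix_matrix_mult_def by (simp, intro tendsto_intros L)
  moreover have "(\<Sum>i\<in>UNIV. (fibre_map (Z 0 b) (munit i p) ** fibre_map (Z 0 b) (munit p q) **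
      fibre_map (Z 0 b) (munit q i)) $ p $ p) = 1" if "b \<noteq> 0" for b
  proof -
    have z: "Z 0 b \<in> generating_tuples" using gen that by simp
    have add: "fibre_map (Z 0 b) (sum g I) = (\<Sum>i\<in>I. fibre_map (Z 0 b) (g i))"
      if "finite I" "I \<noteq> {}" for g :: "'n \<Rightarrow> 'n cmat" and I
      using that by (induction rule: finite_ne_induct) (auto simp: fibre_map_add[OF z])
    have "mat 1 = fibre_map (Z 0 b) (\<Sum>i\<in>UNIV. munit i p ** munit p q ** munit q i)"
      by (simp add: munit_mult mat_1_eq_sum_munit[symmetric] fibre_map_one[OF z])
    then have "mat 1 = (\<Sum>i\<in>UNIV. fibre_map (Z 0 b) (munit i p) ** fibre_map (Z 0 b) (munit p q) **
      fibre_map (Z 0 b) (munit q i))"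
      by (simp add: add fibre_map_mult[OF z])
    from arg_cong[OF this, of "\<lambda>A. A $ p $ p"] show ?thesis by (simp add: mat_def)
  qed
  then have "eventually (\<lambda>b. (\<Sum>i\<in>UNIV. (fibre_map (Z 0 b) (munit i p) ** fibre_map (Z 0 b) (munit p q) **
      fibre_map (Z 0 b) (munit q i)) $ p $ p) = 1) (at 0)"
    by (simp add: eventually_at_filter)
  ultimately have "((\<lambda>b::complex. 1::complex) \<longlongrightarrow>
     (\<Sum>i\<in>UNIV. \<Sum>x\<in>UNIV. (\<Sum>y\<in>UNIV. L (munit i p) p y * L (munit p q) y x) * L (munit q i) x p)) (at 0)"
    using tendsto_cong by fast
  then have "((\<lambda>b::complex. 1::complex) \<longlongrightarrow> 0) (at 0)" by (simp add: L0)
  from tendsto_unique[OF _ this tendsto_const] show False by simp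
qed

end

lemma ex_two_elements:
  assumes "CARD('x::finite) \<ge> 2"
  shows "\<exists>x y :: 'x. x \<noteq> y"
proof -
  obtain T :: "'x set" where "card T = 2"
    using obtain_subset_with_card_n[OF assms] by auto
  then show ?thesis by (auto simp: card_2_iff)
qed

lemma ex_three_elements:
  assumes "CARD('x::finite) \<ge> 3"
  shows "\<exists>x y z :: 'x. y \<noteq> x \<and> z \<noteq> x \<and> y \<noteq> z"
proof -
  obtain T :: "'x set" where "card T = 3"
    using obtain_subset_with_card_n[OF assms] by auto
  then show ?thesis by (auto simp: card_3_iff)
qed

theorem corollary1p3:
  assumes "CARD('d::finite) \<ge> 2" and "CARD('n::finite) \<ge> 2"
    and "(CARD('d), CARD('n)) \<noteq> (2, 2)"
  shows "\<not> trivial_matrix_bundle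
           (matrix_bundle :: (('d, 'n) mpoint, ('d, 'n) qpoint) algebra_bundle) TYPE('n)"
proof
  assume "trivial_matrix_bundle
           (matrix_bundle :: (('d, 'n) mpoint, ('d, 'n) qpoint) algebra_bundle) TYPE('n)"
  then obtain \<Psi> :: "('d, 'n) mpoint \<Rightarrow> ('d, 'n) qpoint \<times> 'n cmat" where
    iso: "algebra_bundle_iso matrix_bundle (product_bundle Q0_space) \<Psi>"
    by (auto simp: trivial_matrix_bundle_def isomorphic_algebra_bundles_def matrix_bundle_def)
  show False
  proof (cases "CARD('d) = 2")
    case False
    obtain p q :: 'n where "q \<noteq> p" using ex_two_elements assms(2) by blast
    moreover have "CARD('d) \<ge> 3" using False assms(1) by simp
    then obtain k0 k1 k2 :: 'd where "k1 \<noteq> k0" "k2 \<noteq> k0" "k1 \<noteq> k2"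
      using ex_three_elements by blast
    ultimately show False
      using no_trivialization[OF iso, of k1 k0 k2 q p q] by simp
  next
    case True
    obtain k0 k1 :: 'd where "k1 \<noteq> k0" using ex_two_elements assms(1) by blast
    moreover have "CARD('n) \<ge> 3" using True assms(2,3) by auto
    then obtain p q r :: 'n where "q \<noteq> p" "r \<noteq> p" "q \<noteq> r"
      using ex_three_elements by blast
    ultimately show False
      using no_trivialization[OF iso, of k1 k0 k1 q p r] by simp
  qed
qed

end
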